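(* Let $\lambda>-1$ and $t\in\mathbb{R}$, and let $S_n(x)=S_n(x;t,\lambda)$, $n\ge0$, be the monic orthogonal polynomials with respect to the generalised sextic Freud weight $\omega(x;t,\lambda)=|x|^{2\lambda+1}\exp(-x^6+tx^2)$ on $\mathbb{R}$, with recurrence coefficients $\beta_n=\beta_n(t;\lambda)$. Then for every $n\ge0$ $$x\frac{\mathrm{d}S_n}{\mathrm{d}x}(x)=\mathcal{A}_n(x)S_{n-1}(x)-\mathcal{B}_n(x)S_n(x),$$ where $$\mathcal{A}_n(x)=6x\beta_n\left[x^4-\tfrac13t+x^2(\beta_n+\beta_{n+1})+\beta_{n+2}\beta_{n+1}+(\beta_{n+1}+\beta_n)^2+\beta_{n-1}\beta_n\right],$$ $$\mathcal{B}_n(x)=6x^2\beta_n\left(x^2+\beta_{n+1}+\beta_n+\beta_{n-1}\right)+(\lambda+\tfrac12)\left[1-(-1)^n\right].$$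
   Context: $S_n(x;t,\lambda)$ is the monic polynomial of degree $n$ with $\int_{-\infty}^\infty S_m(x)S_n(x)\,|x|^{2\lambda+1}\exp(-x^6+tx^2)\,\mathrm{d}x=0$ for $m\ne n$. Since the weight is even, the polynomials satisfy the three-term recurrence $S_{n+1}(x)=xS_n(x)-\beta_n(t;\lambda)S_{n-1}(x)$, $n\ge0$, with $S_{-1}=0$, $S_0=1$, which defines $\beta_n>0$ for $n\ge1$; conventions: $\beta_0=\beta_{-1}=0$. *)

theory Defs
  imports "HOL-Analysis.Analysis" "HOL-Computational_Algebra.Polynomial"
begin

definition freud_weight :: "real \<Rightarrow> real \<Rightarrow> real \<Rightarrow> real" where
  "freud_weight t lam x = \<bar>x\<bar> powr (2 * lam + 1) * exp (- (x ^ 6) + t * x\<^sup>2)"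

(* has_bochner_integral asks for convergence of the integral as well as for its
   value, so a divergent integral does not count as orthogonality. *)
definition monic_orthogonal_polys :: "(real \<Rightarrow> real) \<Rightarrow> (nat \<Rightarrow> real poly) \<Rightarrow> bool" where
  "monic_orthogonal_polys w P \<longleftrightarrow>
     (\<forall>n. degree (P n) = n \<and> lead_coeff (P n) = 1) \<and>
     (\<forall>m n. m \<noteq> n \<longrightarrow>
        has_bochner_integral lborel (\<lambda>x. poly (P m) x * poly (P n) x * w x) 0)"

(* Indices are integers so that S_{-1} = 0 and beta_0 = beta_{-1} = 0 are literal
   conventions; with natural-number indices n - 1 would be truncated at n = 0. *)
definition freud_S :: "real \<Rightarrow> real \<Rightarrow> int \<Rightarrow> real poly" where
  "freud_S t lam n =
     (if n < 0 then 0
      else (THE P. monic_orthogonal_polys (freud_weight t lam) P) (nat n))"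

definition freud_\<beta> :: "real \<Rightarrow> real \<Rightarrow> int \<Rightarrow> real" where
  "freud_\<beta> t lam n =
     (if n \<le> 0 then 0
      else (THE b. freud_S t lam (n + 1) =
                     [:0, 1:] * freud_S t lam n - smult b (freud_S t lam (n - 1))))"

definition freud_A :: "real \<Rightarrow> real \<Rightarrow> nat \<Rightarrow> real \<Rightarrow> real" where
  "freud_A t lam n x =
     (let \<beta> = freud_\<beta> t lam; k = int n in
      6 * x * \<beta> k *
        (x ^ 4 - t / 3 + x\<^sup>2 * (\<beta> k + \<beta> (k + 1)) + \<beta> (k + 2) * \<beta> (k + 1)
          + (\<beta> (k + 1) + \<beta> k)\<^sup>2 + \<beta> (k - 1) * \<beta> k))"

definition freud_B :: "real \<Rightarrow> real \<Rightarrow> nat \<Rightarrow> real \<Rightarrow> real" where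
  "freud_B t lam n x =
     (let \<beta> = freud_\<beta> t lam; k = int n in
      6 * x\<^sup>2 * \<beta> k * (x\<^sup>2 + \<beta> (k + 1) + \<beta> k + \<beta> (k - 1))
        + (lam + 1 / 2) * (1 - (- 1) ^ n))"

end

theory Submission
  imports Defs "HOL-Real_Asymp.Real_Asymp"
begin

text \<open>Write the weight as \<open>|x|^\<gamma> exp (- v x)\<close> with \<open>\<gamma> = 2 \<lambda> + 1\<close> and
\<open>v x = x^6 - t x^2\<close>, and let \<open>L p\<close> be the integral of \<open>p\<close> against it. The derivative
operator adapted to \<open>|x|^\<gamma>\<close> is the Dunkl operator
  \<open>(T p) x = p' x + \<gamma> (p x - p (- x)) / (2 x)\<close>.
It maps polynomials to polynomials, lowers the degree, and integration by parts gives
\<open>L (T p \<cdot> q) + L (p \<cdot> T q) = L (v' p q)\<close> (lemma \<open>dunkl_skew\<close>), with no singular term at the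
origin although the weight itself may be singular there.

If \<open>q\<close> has degree less than \<open>n\<close>, then so does \<open>T q\<close>, hence \<open>S\<^sub>n\<close> is orthogonal to \<open>T q\<close> and
\<open>L (T S\<^sub>n \<cdot> q) = L (v' S\<^sub>n q)\<close>. Since \<open>T S\<^sub>n\<close> has degree less than \<open>n\<close>, it is the part of
\<open>v' S\<^sub>n\<close> below level \<open>n\<close> in the basis of the \<open>S\<^sub>k\<close> (lemma \<open>dunkl_OPS_eqI\<close>). For
\<open>v' = 6 x^5 - 2 t x\<close> the three-term recurrence shows that this part is a combination of
\<open>S\<^sub>n\<^sub>-\<^sub>1\<close>, \<open>S\<^sub>n\<^sub>-\<^sub>3\<close> and \<open>S\<^sub>n\<^sub>-\<^sub>5\<close>, and running the recurrence downwards expresses the last two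
through \<open>S\<^sub>n\<^sub>-\<^sub>1\<close> and \<open>S\<^sub>n\<close> with polynomial coefficients (lemma \<open>dunkl_lowering\<close>). Finally
\<open>S\<^sub>n\<close> has the parity of \<open>n\<close>, so that \<open>x \<cdot> T S\<^sub>n = x S\<^sub>n' + (\<lambda> + 1/2) (1 - (-1)^n) S\<^sub>n\<close>, which
accounts for the last term of \<open>B\<^sub>n\<close>.

The argument uses only that \<open>L\<close> is linear, positive on squares, invariant under
\<open>x \<mapsto> - x\<close> and satisfies a Pearson equation. These properties are collected in a chain of
locales. The hypothesis \<open>\<lambda> > -1\<close> enters when the concrete integral is shown to have them: it
makes \<open>|x|^(2 \<lambda> + 1)\<close> integrable at the origin and kills the boundary terms there.\<close>

section \<open>Reflection of polynomials and odd parts\<close>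

abbreviation X :: "real poly" where "X \<equiv> [:0, 1:]"

definition mirror :: "real poly \<Rightarrow> real poly" where
  "mirror p = pcompose p [:0, -1:]"

lemma poly_mirror [simp]: "poly (mirror p) x = poly p (- x)"
  by (simp add: mirror_def poly_pcompose)

lemma coeff_mirror: "coeff (mirror p) i = (- 1) ^ i * coeff p i"
  by (simp add: mirror_def coeff_pcompose_linear)

lemma poly_ext: "(\<And>x. poly p x = poly q x) \<Longrightarrow> p = (q :: real poly)"
  by (simp add: poly_eq_poly_eq_iff[symmetric] fun_eq_iff)

lemma mirror_mult: "mirror (p * q) = mirror p * mirror q"
  by (simp add: mirror_def pcompose_mult)

lemma pderiv_mirror: "pderiv (mirror p) = - mirror (pderiv p)"
  by (simp add: mirror_def pderiv_pcompose pderiv_pCons)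

definition odd_quot :: "real poly \<Rightarrow> real poly" where
  "odd_quot p = (p - mirror p) div [:0, 2:]"

text \<open>The numerator vanishes at \<open>0\<close>, so the division is exact.\<close>

lemma X_odd_quot: "X * odd_quot p = smult (1 / 2) (p - mirror p)"
proof -
  have "X dvd p - mirror p" using poly_eq_0_iff_dvd[of "p - mirror p" 0] by simp
  then obtain r where r: "p - mirror p = X * r" by (elim dvdE)
  have "p - mirror p = smult (1/2) r * [:0,2:]" by (simp add: r)
  then have "odd_quot p = smult (1/2) r"
    unfolding odd_quot_def by (metis nonzero_mult_div_cancel_right pCons_eq_0_iff zero_neq_numeral)
  with r show ?thesis by simp
qed

lemma poly_odd_quot: "x * poly (odd_quot p) x = (poly p x - poly p (- x)) / 2"
  using arg_cong[OF X_odd_quot, of "\<lambda>q. poly q x" p] by simp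

lemma coeff_odd_quot: "coeff (odd_quot p) i = (1 + (- 1) ^ i) / 2 * coeff p (Suc i)"
  using arg_cong[OF X_odd_quot, of "\<lambda>q. coeff q (Suc i)" p]
  by (simp add: coeff_mirror algebra_simps add_divide_distrib)

lemma mirror_odd_quot: "mirror (odd_quot p) = odd_quot p"
  by (rule poly_eqI) (auto simp: coeff_mirror coeff_odd_quot uminus_power_if)

text \<open>The Leibniz rule for the difference part of the Dunkl operator. The correction term is odd, so
every even functional annihilates it; this is why the rule becomes exact after integration.\<close>

lemma odd_quot_mult:
  "odd_quot p * q + p * odd_quot q = odd_quot (p * q) + smult 2 (X * odd_quot p * odd_quot q)"
proof -
  \<comment> \<open>After multiplication by \<open>X\<close> the claim is an identity between values at \<open>x\<close> and \<open>- x\<close>.\<close>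
  have "X * (odd_quot p * q + p * odd_quot q)
      = X * (odd_quot (p * q) + smult 2 (X * odd_quot p * odd_quot q))"
  proof (rule poly_ext)
    fix x
    define a where "a = poly (odd_quot p) x"
    define b where "b = poly (odd_quot q) x"
    define c where "c = poly (odd_quot (p * q)) x"
    have "2 * (x * a) = poly p x - poly p (- x)" "2 * (x * b) = poly q x - poly q (- x)"
      "2 * (x * c) = poly p x * poly q x - poly p (- x) * poly q (- x)"
      by (simp_all add: poly_odd_quot a_def b_def c_def)
    then have "x * (a * poly q x + poly p x * b) = x * (c + 2 * (x * a * b))"
      by algebra
    then show "poly (X * (odd_quot p * q + p * odd_quot q)) x
      = poly (X * (odd_quot (p * q) + smult 2 (X * odd_quot p * odd_quot q))) x"
      by (simp add: a_def b_def c_def algebra_simps)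
  qed
  then show ?thesis by (metis mult_cancel_left pCons_eq_0_iff zero_neq_one)
qed

section \<open>Orthogonal polynomials of a positive functional\<close>

text \<open>An induction principle: monic polynomials, one in each degree, span all polynomials. The bound on
the degree is stated through coefficients so that \<open>n = 0\<close> correctly forces \<open>q = 0\<close>.\<close>

lemma graded_span:
  fixes P :: "nat \<Rightarrow> real poly"
  assumes deg: "\<And>k. degree (P k) = k" and lc: "\<And>k. coeff (P k) k = 1"
    and V0: "V 0" and Va: "\<And>p q. V p \<Longrightarrow> V q \<Longrightarrow> V (p + q)" and Vs: "\<And>c p. V p \<Longrightarrow> V (smult c p)"
    and VP: "\<And>k. k < n \<Longrightarrow> V (P k)" and q: "\<And>i. n \<le> i \<Longrightarrow> coeff q i = 0"
  shows "V q"
  using VP q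
proof (induction n arbitrary: q)
  case 0
  then have "q = 0" by (simp add: poly_eq_iff)
  then show ?case using V0 by simp
next
  case (Suc n)
  define r where "r = q - smult (coeff q n) (P n)"
  have "coeff r i = 0" if "n \<le> i" for i
    using that Suc.prems(2)[of i] deg[of n] lc[of n] coeff_eq_0[of "P n" i]
    by (cases "i = n") (auto simp: r_def)
  then have "V r" using Suc by (meson less_Suc_eq)
  moreover have "q = r + smult (coeff q n) (P n)" by (simp add: r_def)
  ultimately show ?case using Va Vs Suc.prems(1) by (metis lessI)
qed

locale positive_functional =
  fixes L :: "real poly \<Rightarrow> real"
  assumes L_add: "L (p + q) = L p + L q"
    and L_smult: "L (smult c p) = c * L p"
    and L_pos: "p \<noteq> 0 \<Longrightarrow> 0 < L (p * p)"
begin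

lemma L_0 [simp]: "L 0 = 0"
  using L_smult[of 0 0] by simp

lemma L_minus: "L (- p) = - L p"
  using L_smult[of "-1" p] by simp

lemma L_diff: "L (p - q) = L p - L q"
  using L_add[of p "- q"] by (simp add: L_minus)

lemma L_sum: "L (sum f A) = (\<Sum>a\<in>A. L (f a))"
  by (induction A rule: infinite_finite_induct) (simp_all add: L_add)

definition monic_OPS :: "(nat \<Rightarrow> real poly) \<Rightarrow> bool" where
  "monic_OPS P \<longleftrightarrow> (\<forall>n. degree (P n) = n \<and> lead_coeff (P n) = 1) \<and>
     (\<forall>m n. m \<noteq> n \<longrightarrow> L (P m * P n) = 0)"

lemma OPS_coeff:
  assumes "monic_OPS P"
  shows "coeff (P n) n = 1" "n < i \<Longrightarrow> coeff (P n) i = 0"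
  using assms coeff_eq_0[of "P n" i] unfolding monic_OPS_def by metis+

lemma OPS_orthogonal_lower:
  assumes P: "monic_OPS P" and q: "\<And>i. n \<le> i \<Longrightarrow> coeff q i = 0"
  shows "L (P n * q) = 0"
  by (rule graded_span[where P = P and V = "\<lambda>q. L (P n * q) = 0" and n = n])
    (use P q OPS_coeff[OF P] in \<open>auto simp: monic_OPS_def algebra_simps L_add L_smult\<close>)

text \<open>By \<open>graded_span\<close>, \<open>q\<close> is orthogonal to itself. Identities between orthogonal
polynomials are proved below by applying this to the difference of the two sides.\<close>

lemma OPS_complete:
  assumes P: "monic_OPS P" and q: "\<And>i. n \<le> i \<Longrightarrow> coeff q i = 0"
    and orth: "\<And>k. k < n \<Longrightarrow> L (q * P k) = 0"
  shows "q = 0"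
proof -
  have "L (q * q) = 0"
    by (rule graded_span[where P = P and V = "\<lambda>r. L (q * r) = 0" and n = n])
      (use P q orth OPS_coeff[OF P] in \<open>auto simp: monic_OPS_def algebra_simps L_add L_smult\<close>)
  then show ?thesis using L_pos[of q] by force
qed

lemma OPS_unique:
  assumes P: "monic_OPS P" and Q: "monic_OPS Q"
  shows "P = Q"
proof
  fix n
  have "P n - Q n = 0"
  proof (rule OPS_complete[OF P])
    fix i assume "n \<le> i"
    then show "coeff (P n - Q n) i = 0"
      using OPS_coeff[OF P, of n] OPS_coeff[OF Q, of n] by (cases "i = n") auto
  next
    fix k assume "k < n"
    then have "L (P n * P k) = 0" "L (Q n * P k) = 0"
      using OPS_coeff[OF P, of k] by (auto intro!: OPS_orthogonal_lower P Q)
    then show "L ((P n - Q n) * P k) = 0" by (simp add: left_diff_distrib L_diff)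
  qed
  then show "P n = Q n" by simp
qed

fun gram_schmidt :: "nat \<Rightarrow> real poly" where
  "gram_schmidt n = monom 1 n - (\<Sum>k<n. smult
     (L (monom 1 n * gram_schmidt k) / L (gram_schmidt k * gram_schmidt k)) (gram_schmidt k))"

declare gram_schmidt.simps [simp del]

lemma coeff_gram_schmidt: "n \<le> i \<Longrightarrow> coeff (gram_schmidt n) i = (if i = n then 1 else 0)"
proof (induction n arbitrary: i rule: less_induct)
  case (less n)
  then show ?case
    by (subst gram_schmidt.simps) (simp add: coeff_sum)
qed

text \<open>By induction, the only summand of \<open>gram_schmidt n\<close> that survives multiplication by
\<open>gram_schmidt k\<close> is the \<open>k\<close>-th one, whose coefficient was chosen to cancel the contribution of
\<open>monom 1 n\<close>.\<close>

lemma gram_schmidt_orthogonal: "k < n \<Longrightarrow> L (gram_schmidt n * gram_schmidt k) = 0"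
proof (induction n arbitrary: k rule: less_induct)
  case (less n)
  let ?g = gram_schmidt
  have "?g k \<noteq> 0" using coeff_gram_schmidt[of k k] by auto
  then have pos: "L (?g k * ?g k) \<noteq> 0" using L_pos by force
  have orth: "L (?g j * ?g k) = 0" if "j < n" "j \<noteq> k" for j
    using that less.IH[of j k] less.IH[of k j] less.prems by (cases "j < k") (auto simp: mult.commute)
  have "(\<Sum>j<n. L (monom 1 n * ?g j) / L (?g j * ?g j) * L (?g j * ?g k))
      = (\<Sum>j\<in>{k}. L (monom 1 n * ?g j) / L (?g j * ?g j) * L (?g j * ?g k))"
    by (rule sum.mono_neutral_right) (use less.prems orth in auto)
  also have "\<dots> = L (monom 1 n * ?g k)" using pos by simp
  finally have "L (monom 1 n * ?g k) = (\<Sum>j<n. L (monom 1 n * ?g j) / L (?g j * ?g j) * L (?g j * ?g k))" ..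
  then show ?case
    by (subst (1) gram_schmidt.simps) (simp add: left_diff_distrib L_diff sum_distrib_right L_sum L_smult)
qed

lemma OPS_exists: "monic_OPS gram_schmidt"
proof -
  have deg: "degree (gram_schmidt n) = n" for n
    using coeff_gram_schmidt[of n] by (intro antisym degree_le le_degree) auto
  moreover have "L (gram_schmidt m * gram_schmidt n) = 0" if "m \<noteq> n" for m n
    using that gram_schmidt_orthogonal[of m n] gram_schmidt_orthogonal[of n m]
    by (cases "m < n") (auto simp: mult.commute)
  ultimately show ?thesis
    using coeff_gram_schmidt by (auto simp: monic_OPS_def)
qed

end

locale even_functional = positive_functional +
  assumes L_mirror: "L (mirror p) = L p"
begin

lemma L_odd: "mirror p = - p \<Longrightarrow> L p = 0"
  using L_mirror[of p] L_minus[of p] by simp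

text \<open>The reflected polynomials, rescaled to be monic, are again orthogonal; uniqueness applies.\<close>

lemma OPS_parity:
  assumes P: "monic_OPS P"
  shows "mirror (P n) = smult ((- 1) ^ n) (P n)"
proof -
  define Q where "Q k = smult ((- 1) ^ k) (mirror (P k))" for k
  have deg: "degree (Q k) = k" for k
    using OPS_coeff[OF P, of k] by (intro antisym degree_le le_degree) (auto simp: Q_def coeff_mirror)
  have "lead_coeff (Q k) = 1" for k
    unfolding deg using OPS_coeff[OF P, of k]
    by (simp add: Q_def coeff_mirror flip: power_mult_distrib)
  moreover have "L (Q m * Q k) = 0" if "m \<noteq> k" for m k
    using that P by (simp add: Q_def L_smult L_mirror monic_OPS_def flip: mirror_mult)
  ultimately have "monic_OPS Q" using deg by (simp add: monic_OPS_def)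
  from OPS_unique[OF P this] have "P n = smult ((- 1) ^ n) (mirror (P n))" by (metis Q_def)
  then have "smult ((- 1) ^ n) (P n) = smult ((- 1) ^ n * (- 1) ^ n) (mirror (P n))"
    by (metis smult_smult)
  then show ?thesis by (simp flip: power_mult_distrib)
qed

text \<open>This is why the three-term recurrence of an even functional has no diagonal term.\<close>

lemma OPS_diagonal:
  assumes P: "monic_OPS P"
  shows "L (X * (P k * P k)) = 0"
proof (rule L_odd)
  show "mirror (X * (P k * P k)) = - (X * (P k * P k))"
    unfolding mirror_mult OPS_parity[OF P]
    by (rule poly_ext) (auto simp flip: power_mult_distrib power_add)
qed

lemma OPS_first:
  assumes P: "monic_OPS P"
  shows "P (Suc 0) = X * P 0"
proof -
  have "X * P 0 - P (Suc 0) = 0"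
  proof (rule OPS_complete[OF P, where n = 1])
    fix i :: nat assume "1 \<le> i"
    then show "coeff (X * P 0 - P (Suc 0)) i = 0"
      using OPS_coeff[OF P, of 0] OPS_coeff[OF P, of 1]
      by (cases i; cases "i = 1") (auto simp: coeff_pCons)
  next
    fix k :: nat assume "k < 1"
    have "L (X * (P 0 * P 0)) = 0" by (rule OPS_diagonal[OF P])
    moreover have "L (P (Suc 0) * P 0) = 0" using P by (simp add: monic_OPS_def)
    ultimately show "L ((X * P 0 - P (Suc 0)) * P k) = 0"
      using \<open>k < 1\<close> by (simp add: left_diff_distrib L_diff mult.assoc)
  qed
  then show ?thesis by simp
qed

text \<open>\<open>X * P (n + 1)\<close> is orthogonal to \<open>P k\<close> for \<open>k < n\<close> because multiplication by \<open>X\<close> can be moved to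
\<open>P k\<close>, and for \<open>k = n + 1\<close> by parity. Only the component along \<open>P n\<close> is left.\<close>

lemma OPS_three_term:
  assumes P: "monic_OPS P"
  shows "\<exists>b. P (Suc (Suc n)) = X * P (Suc n) - smult b (P n)"
proof -
  define b where "b = L (X * P (Suc n) * P n) / L (P n * P n)"
  have orth: "L (P i * P j) = 0" if "i \<noteq> j" for i j using P that by (simp add: monic_OPS_def)
  have "P n \<noteq> 0" using OPS_coeff(1)[OF P, of n] by auto
  then have pos: "L (P n * P n) \<noteq> 0" using L_pos by force
  have "X * P (Suc n) - P (Suc (Suc n)) - smult b (P n) = 0"
  proof (rule OPS_complete[OF P, where n = "Suc (Suc n)"])
    fix i :: nat assume "Suc (Suc n) \<le> i"
    then show "coeff (X * P (Suc n) - P (Suc (Suc n)) - smult b (P n)) i = 0"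
      using OPS_coeff[OF P, of n] OPS_coeff[OF P, of "Suc n"] OPS_coeff[OF P, of "Suc (Suc n)"]
      by (cases i; cases "i = Suc (Suc n)") (auto simp: coeff_pCons)
  next
    fix k :: nat assume k: "k < Suc (Suc n)"
    have "L (X * P (Suc n) * P k) = b * L (P n * P k)"
    proof (cases "k < n")
      case True
      have "L (P (Suc n) * (X * P k)) = 0"
        by (rule OPS_orthogonal_lower[OF P])
          (use OPS_coeff[OF P, of k] True in \<open>auto simp: coeff_pCons split: nat.splits\<close>)
      then show ?thesis using orth[of n k] True by (simp add: ac_simps)
    next
      case False
      then consider "k = n" | "k = Suc n" using k by linarith
      then show ?thesis
      proof cases
        case 1
        then show ?thesis using pos by (simp add: b_def)
      next
        case 2
        then show ?thesis using OPS_diagonal[OF P, of k] orth[of n k] by (simp add: ac_simps)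
      qed
    qed
    then show "L ((X * P (Suc n) - P (Suc (Suc n)) - smult b (P n)) * P k) = 0"
      using orth[of "Suc (Suc n)" k] k by (simp add: left_diff_distrib L_diff L_smult)
  qed
  then have "P (Suc (Suc n)) = X * P (Suc n) - smult b (P n)" by (simp add: algebra_simps)
  then show ?thesis ..
qed

end

section \<open>The Dunkl operator of a semiclassical functional\<close>

text \<open>For a weight \<open>|x|^\<gamma> exp (- v x)\<close> with \<open>v\<close> even and \<open>V = v'\<close>, the Pearson equation says that the
derivative of the product of \<open>x r(x)\<close> and the weight integrates to zero. The factor \<open>x\<close> cancels the pole of the
logarithmic derivative of \<open>|x|^\<gamma>\<close>, so everything is stated with polynomials.\<close>

locale semiclassical_functional = even_functional +
  fixes \<gamma> :: real and V :: "real poly"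
  assumes V_odd: "mirror V = - V"
    and pearson: "L (pderiv (X * r)) + \<gamma> * L r = L (V * (X * r))"
begin

definition dunkl :: "real poly \<Rightarrow> real poly" where
  "dunkl p = pderiv p + smult \<gamma> (odd_quot p)"

lemma coeff_dunkl:
  "(\<And>i. Suc n \<le> i \<Longrightarrow> coeff p i = 0) \<Longrightarrow> n \<le> i \<Longrightarrow> coeff (dunkl p) i = 0"
  by (simp add: dunkl_def coeff_pderiv coeff_odd_quot)

text \<open>Split \<open>p q = x r + e\<close> into its odd and its even part. The derivative and the potential term of \<open>e\<close>
are odd and integrate to zero, the difference quotients contribute \<open>L r\<close> by \<open>odd_quot_mult\<close>, and
what remains is the Pearson equation for \<open>r\<close>.\<close>

lemma dunkl_skew: "L (dunkl p * q) + L (p * dunkl q) = L (V * (p * q))"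
proof -
  define r where "r = odd_quot (p * q)"
  define e where "e = smult (1 / 2) (p * q + mirror (p * q))"
  have e: "mirror e = e" by (rule poly_ext) (simp add: e_def)
  have split: "p * q = X * r + e"
    by (rule poly_ext) (simp add: e_def r_def poly_odd_quot field_simps)
  have "mirror (pderiv e) = - pderiv e" using pderiv_mirror[of e] e by simp
  then have 1: "L (pderiv (p * q)) = L (pderiv (X * r))"
    unfolding split by (simp add: pderiv_add L_add L_odd del: mult_pCons_left)
  have "mirror (V * e) = - (V * e)" by (simp add: mirror_mult e V_odd)
  then have 2: "L (V * (p * q)) = L (V * (X * r))"
    unfolding split by (simp add: distrib_left L_add L_odd del: mult_pCons_left)
  have "mirror (X * odd_quot p * odd_quot q) = - (X * odd_quot p * odd_quot q)"
    unfolding mirror_mult mirror_odd_quot by (rule poly_ext) simp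
  then have 3: "L (odd_quot p * q + p * odd_quot q) = L r"
    unfolding odd_quot_mult r_def[symmetric] by (simp add: L_add L_smult L_odd del: mult_pCons_left)
  have "dunkl p * q + p * dunkl q
      = pderiv (p * q) + smult \<gamma> (odd_quot p * q + p * odd_quot q)"
    by (simp add: dunkl_def pderiv_mult algebra_simps smult_add_right)
  then show ?thesis
    using pearson[of r] by (metis 1 2 3 L_add L_smult)
qed

text \<open>\<open>T (P n)\<close> is the component of \<open>V * P n\<close> below level \<open>n\<close>: against \<open>P k\<close> with \<open>k < n\<close> the second
term of the adjoint relation vanishes, as \<open>T (P k)\<close> has degree less than \<open>n\<close>.\<close>

lemma dunkl_OPS_eqI:
  assumes P: "monic_OPS P" and D: "\<And>i. n \<le> i \<Longrightarrow> coeff D i = 0"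
    and orth: "\<And>k. k < n \<Longrightarrow> L ((V * P n - D) * P k) = 0"
  shows "dunkl (P n) = D"
proof -
  have "dunkl (P n) - D = 0"
  proof (rule OPS_complete[OF P, where n = n])
    show "coeff (dunkl (P n) - D) i = 0" if "n \<le> i" for i
      using that D coeff_dunkl[of n "P n" i] OPS_coeff[OF P, of n] by simp
    fix k assume k: "k < n"
    have "L (P n * dunkl (P k)) = 0"
      by (rule OPS_orthogonal_lower[OF P])
        (use OPS_coeff[OF P, of k] k coeff_dunkl[of n "P k"] in auto)
    then show "L ((dunkl (P n) - D) * P k) = 0"
      using orth[OF k] dunkl_skew[of "P n" "P k"] by (simp add: left_diff_distrib L_diff mult.assoc)
  qed
  then show ?thesis by simp
qed

end

section \<open>The lowering relation for the sextic potential\<close>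

text \<open>The derivative \<open>6 x^5 - 2 t x\<close> of \<open>x^6 - t x^2\<close>.\<close>

abbreviation sextic_slope :: "real \<Rightarrow> real poly" where
  "sextic_slope t \<equiv> [:0, - 2 * t, 0, 0, 0, 6:]"

locale freud_functional = semiclassical_functional +
  fixes t :: real
  assumes V_freud: "V = sextic_slope t"
begin

text \<open>\<open>V * S k\<close> is expanded by repeated use of the recurrence into \<open>U + D\<close>, where \<open>U\<close> collects the terms
above level \<open>k\<close> and \<open>D\<close> those below; there is none at level \<open>k\<close> by parity. The coefficients count
weighted lattice paths: in an expansion of \<open>x^5 S\<^sub>k\<close> each of the five factors \<open>x\<close> either raises the index
or lowers it from \<open>j\<close> to \<open>j - 1\<close> at the price of \<open>b j\<close>. Thus \<open>D = T (S k)\<close>, and eliminating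
\<open>S (k - 3)\<close> and \<open>S (k - 5)\<close> from \<open>D\<close> gives the stated form.\<close>

lemma dunkl_lowering:
  fixes S :: "int \<Rightarrow> real poly" and b :: "int \<Rightarrow> real" and n :: nat
  assumes OPS: "monic_OPS (\<lambda>n. S (int n))"
    and Sneg: "\<And>k. k < 0 \<Longrightarrow> S k = 0" and b0: "\<And>k. k \<le> 0 \<Longrightarrow> b k = 0"
    and rec: "\<And>k. 0 \<le> k \<Longrightarrow> S (k + 1) = X * S k - smult (b k) (S (k - 1))"
  defines "k \<equiv> int n"
  shows "poly (dunkl (S k)) x =
      6 * b k * (x ^ 4 - t / 3 + x\<^sup>2 * (b k + b (k + 1)) + b (k + 2) * b (k + 1)
        + (b (k + 1) + b k)\<^sup>2 + b (k - 1) * b k) * poly (S (k - 1)) x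
      - 6 * x * b k * (x\<^sup>2 + b (k + 1) + b k + b (k - 1)) * poly (S k) x"
proof -
  define b1 where "b1 = b (k + 1)"
  define b2 where "b2 = b (k + 2)"
  define b3 where "b3 = b (k + 3)"
  define b4 where "b4 = b (k + 4)"
  define a0 where "a0 = b k"
  define a1 where "a1 = b (k - 1)"
  define a2 where "a2 = b (k - 2)"
  define a3 where "a3 = b (k - 3)"
  define a4 where "a4 = b (k - 4)"
  note bs = b1_def b2_def b3_def b4_def a0_def a1_def a2_def a3_def a4_def
  define K where "K = 6 * (a2*a1 + a1\<^sup>2 + 2*a1*a0 + a1*b1 + a0\<^sup>2 + 2*a0*b1 + b1\<^sup>2 + b1*b2) - 2*t"
  define D where "D = smult (a0 * K) (S (k - 1))
    + smult (6 * a0*a1*a2 * (b1 + a0 + a1 + a2 + a3)) (S (k - 3))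
    + smult (6 * a0*a1*a2*a3*a4) (S (k - 5))"
  define K' where "K' = 6 * (a1*a0 + a0\<^sup>2 + 2*a0*b1 + a0*b2 + b1\<^sup>2 + 2*b1*b2 + b2\<^sup>2 + b2*b3) - 2*t"
  define U where "U = smult K' (S (k + 1)) + smult (6 * (a0 + b1 + b2 + b3 + b4)) (S (k + 3))
    + smult 6 (S (k + 5))"
  have up: "x * poly (S j) x = poly (S (j + 1)) x + b j * poly (S (j - 1)) x" if "0 \<le> j" for j x
    using rec[OF that] by simp
  have u0: "x * poly (S k) x = poly (S (k + 1)) x + a0 * poly (S (k - 1)) x"
    and u1: "x * poly (S (k + 1)) x = poly (S (k + 2)) x + b1 * poly (S k) x"
    and u2: "x * poly (S (k + 2)) x = poly (S (k + 3)) x + b2 * poly (S (k + 1)) x"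
    and u3: "x * poly (S (k + 3)) x = poly (S (k + 4)) x + b3 * poly (S (k + 2)) x"
    and u4: "x * poly (S (k + 4)) x = poly (S (k + 5)) x + b4 * poly (S (k + 3)) x" for x
    using up[of k x] up[of "k + 1" x] up[of "k + 2" x] up[of "k + 3" x] up[of "k + 4" x]
    by (simp_all add: bs k_def algebra_simps)
  \<comment> \<open>The recurrence fails at index \<open>-1\<close>, where it would say \<open>S 0 = 0\<close>. Multiplied by the path
    weights it holds for every \<open>k\<close>: once the index becomes negative, one of the factors is \<open>b 0 = 0\<close>.\<close>
  have d1: "a0 * (x * poly (S (k - 1)) x) = a0 * (poly (S k) x + a1 * poly (S (k - 2)) x)" for x
    using up[of "k - 1" x] b0[of k] by (cases "1 \<le> k") (simp_all add: bs)
  have d2: "a0*a1 * (x * poly (S (k - 2)) x) = a0*a1 * (poly (S (k - 1)) x + a2 * poly (S (k - 3)) x)" for x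
    using up[of "k - 2" x] b0[of "k - 1"] by (cases "2 \<le> k") (simp_all add: bs)
  have d3: "a0*a1*a2 * (x * poly (S (k - 3)) x) = a0*a1*a2 * (poly (S (k - 2)) x + a3 * poly (S (k - 4)) x)" for x
    using up[of "k - 3" x] b0[of "k - 2"] by (cases "3 \<le> k") (simp_all add: bs)
  have d4: "a0*a1*a2*a3 * (x * poly (S (k - 4)) x) = a0*a1*a2*a3 * (poly (S (k - 3)) x + a4 * poly (S (k - 5)) x)" for x
    using up[of "k - 4" x] b0[of "k - 3"] by (cases "4 \<le> k") (simp_all add: bs)
  have D: "poly D x = 6 * a0 * (x ^ 4 - t / 3 + x\<^sup>2 * (a0 + b1) + b2 * b1 + (b1 + a0)\<^sup>2 + a1 * a0)
        * poly (S (k - 1)) x - 6 * x * a0 * (x\<^sup>2 + b1 + a0 + a1) * poly (S k) x" for x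
  proof -
    have y2: "a0*a1 * poly (S (k - 2)) x = x * (a0 * poly (S (k - 1)) x) - a0 * poly (S k) x"
      using d1[of x] by algebra
    have y3: "a0*a1*a2 * poly (S (k - 3)) x = x * (a0*a1 * poly (S (k - 2)) x) - a0*a1 * poly (S (k - 1)) x"
      using d2[of x] by algebra
    have y4: "a0*a1*a2*a3 * poly (S (k - 4)) x = x * (a0*a1*a2 * poly (S (k - 3)) x) - a2 * (a0*a1 * poly (S (k - 2)) x)"
      using d3[of x] by algebra
    have y5: "a0*a1*a2*a3*a4 * poly (S (k - 5)) x = x * (a0*a1*a2*a3 * poly (S (k - 4)) x) - a3 * (a0*a1*a2 * poly (S (k - 3)) x)"
      using d4[of x] by algebra
    have "poly D x = K * (a0 * poly (S (k - 1)) x)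
        + 6 * (b1 + a0 + a1 + a2 + a3) * (a0*a1*a2 * poly (S (k - 3)) x)
        + 6 * (a0*a1*a2*a3*a4 * poly (S (k - 5)) x)"
      by (simp add: D_def)
    then show ?thesis
      unfolding y5 y4 y3 y2 K_def by (simp add: algebra_simps power2_eq_square eval_nat_numeral)
  qed
  have "V * S k = U + D"
  proof (rule poly_ext)
    fix x
    have 3: "x^3 * poly (S k) x = poly (S (k + 3)) x + (b2 + b1 + a0) * poly (S (k + 1)) x
        + a0 * (b1 + a0 + a1) * poly (S (k - 1)) x + a0*a1*a2 * poly (S (k - 3)) x"
      using u0[of x] u1[of x] u2[of x] d1[of x] d2[of x] by algebra
    have up2: "x^2 * poly (S (k + 3)) x = poly (S (k + 5)) x + (b4 + b3) * poly (S (k + 3)) x + b3 * b2 * poly (S (k + 1)) x"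
      "x^2 * poly (S (k + 1)) x = poly (S (k + 3)) x + (b2 + b1) * poly (S (k + 1)) x + b1 * a0 * poly (S (k - 1)) x"
      using u0[of x] u1[of x] u2[of x] u3[of x] u4[of x] by algebra+
    have dn2: "a0 * (x^2 * poly (S (k - 1)) x) = a0 * (poly (S (k + 1)) x + (a0 + a1) * poly (S (k - 1)) x + a1 * a2 * poly (S (k - 3)) x)"
      "a0*a1*a2 * (x^2 * poly (S (k - 3)) x) = a0*a1*a2 * (poly (S (k - 1)) x + (a2 + a3) * poly (S (k - 3)) x + a3 * a4 * poly (S (k - 5)) x)"
      using u0[of x] d1[of x] d2[of x] d3[of x] d4[of x] by algebra+
    have "x^5 * poly (S k) x = x^2 * (x^3 * poly (S k) x)" by algebra
    then have "6 * x^5 * poly (S k) x = 6 * (x^2 * poly (S (k + 3)) x + (b2 + b1 + a0) * (x^2 * poly (S (k + 1)) x)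
        + (b1 + a0 + a1) * (a0 * (x^2 * poly (S (k - 1)) x)) + a0*a1*a2 * (x^2 * poly (S (k - 3)) x))"
      unfolding 3 by algebra
    then have "6 * x^5 * poly (S k) x - 2 * t * (x * poly (S k) x) = poly U x + poly D x"
      unfolding up2 dn2 u0 by (simp add: U_def D_def K_def K'_def algebra_simps power2_eq_square)
    then show "poly (V * S k) x = poly (U + D) x"
      by (simp add: V_freud algebra_simps power2_eq_square power3_eq_cube eval_nat_numeral)
  qed
  then have U: "V * S k - D = U" by simp
  have "dunkl (S (int n)) = D"
  proof (rule dunkl_OPS_eqI[OF OPS])
    fix i assume i: "n \<le> i"
    have low: "coeff (S j) i = 0" if "j < k" for j
      using Sneg[of j] OPS_coeff(2)[OF OPS, of "nat j" i] that i
      by (cases "0 \<le> j") (auto simp: k_def)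
    show "coeff D i = 0" by (simp add: D_def low)
  next
    fix m assume m: "m < n"
    have orth: "L (S j * S (int m)) = 0" if "k < j" for j
    proof -
      have "int (nat j) = j" "nat j \<noteq> m" using that m by (auto simp: k_def)
      moreover have "L (S (int (nat j)) * S (int m)) = 0"
        using OPS \<open>nat j \<noteq> m\<close> unfolding monic_OPS_def by blast
      ultimately show ?thesis by simp
    qed
    have "L (U * S (int m)) = 0"
      by (simp add: U_def distrib_right L_add L_smult orth)
    then show "L ((V * S (int n) - D) * S (int m)) = 0" using U by (simp add: k_def)
  qed
  then show ?thesis using D[of x] by (simp add: k_def bs)
qed

end

section \<open>Integration against the sextic Freud weight\<close>

lemma weight_nonneg: "0 \<le> freud_weight t lam x"
  by (simp add: freud_weight_def)

lemma weight_even: "freud_weight t lam (- x) = freud_weight t lam x"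
  by (simp add: freud_weight_def)

lemma weight_measurable [measurable]: "freud_weight t lam \<in> borel_measurable borel"
  unfolding freud_weight_def by measurable

text \<open>The constant comes from \<open>y \<le> 1 + y^2\<close> and, with \<open>z = y^2\<close> and \<open>a = 1 + |t|\<close>, from
\<open>a z - z^3 \<le> a^2\<close>. It bounds the weight by a multiple of \<open>|x|^(2 \<lambda> + 1) exp (- |x|)\<close>, the
integrand of the Gamma function.\<close>

lemma sextic_bound:
  fixes t y :: real
  assumes "0 \<le> y"
  shows "y - y ^ 6 + t * y\<^sup>2 \<le> 1 + (1 + \<bar>t\<bar>)\<^sup>2"
proof -
  define z where "z = y\<^sup>2"
  define a where "a = 1 + \<bar>t\<bar>"
  have z: "0 \<le> z" and a: "1 \<le> a" by (simp_all add: z_def a_def)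
  have "0 \<le> (y - 1)\<^sup>2" by simp
  then have "y \<le> 1 + z" using assms by (simp add: z_def power2_diff)
  moreover have "t * z \<le> \<bar>t\<bar> * z" using z by (intro mult_right_mono) auto
  ultimately have *: "y - y ^ 6 + t * y\<^sup>2 \<le> 1 + a * z - z ^ 3"
    by (simp add: z_def a_def algebra_simps flip: power_mult)
  have "a * z - z ^ 3 \<le> a\<^sup>2"
  proof (cases "z \<le> a")
    case True
    then have "a * z \<le> a\<^sup>2" using a by (simp add: power2_eq_square)
    then show ?thesis using z by (smt (verit) zero_le_power)
  next
    case False
    then have "a \<le> z\<^sup>2" using a by (smt (verit) power2_eq_square mult_le_cancel_left1 mult_left_mono)
    then have "a * z \<le> z\<^sup>2 * z" using z by (rule mult_right_mono)
    then show ?thesis by (simp add: power3_eq_cube power2_eq_square) (smt (verit) mult_nonneg_nonneg a)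
  qed
  with * show ?thesis by (simp add: a_def)
qed

text \<open>The logarithmic derivative of the weight is \<open>(2 \<lambda> + 1) / x - v' x\<close>, on both sides of the origin.\<close>

lemma weight_derivative:
  assumes "x \<noteq> 0"
  shows "((\<lambda>x. poly (X * r) x * freud_weight t lam x) has_real_derivative
    poly (pderiv (X * r) + smult (2 * lam + 1) r - sextic_slope t * (X * r)) x * freud_weight t lam x) (at x)"
proof -
  have deriv: "((\<lambda>x. x powr c) has_real_derivative c * x powr c / x) (at x)" if "0 < x" for c x :: real
    using has_real_derivative_powr[OF that, of c] that by (simp add: powr_diff)
  have a: "((\<lambda>x. \<bar>x\<bar> powr (2 * lam + 1)) has_real_derivative (2 * lam + 1) * \<bar>x\<bar> powr (2 * lam + 1) / x) (at x)"
  proof (cases "x > 0")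
    case True
    then show ?thesis
      by (intro has_field_derivative_transform_within_open[OF deriv[OF True], where S = "{0<..}", THEN DERIV_cong]) auto
  next
    case False
    then have "0 < - x" using assms by simp
    then have "((\<lambda>x. (- x) powr (2 * lam + 1)) has_real_derivative (2 * lam + 1) * (- x) powr (2 * lam + 1) / x) (at x)"
      using DERIV_chain2[OF deriv[of "- x"] DERIV_minus[OF DERIV_ident]] by simp
    then show ?thesis
      by (rule has_field_derivative_transform_within_open[where S = "{..<0}", THEN DERIV_cong]) (use \<open>0 < - x\<close> in auto)
  qed
  show ?thesis unfolding freud_weight_def
    by (rule derivative_eq_intros a poly_DERIV refl)+
       (use assms in \<open>simp add: field_simps eval_nat_numeral\<close>)
qed

lemma weight_isCont: "x \<noteq> 0 \<Longrightarrow> isCont (\<lambda>x. poly p x * freud_weight t lam x) x"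
  unfolding freud_weight_def by (intro continuous_intros) auto

lemma poly_weight_at_top: "((\<lambda>x. poly p x * freud_weight t lam x) \<longlongrightarrow> 0) at_top"
proof -
  have "((\<lambda>x. x ^ n * freud_weight t lam x) \<longlongrightarrow> 0) at_top" for n
  proof -
    have "((\<lambda>x. x powr (real n + 2 * lam + 1) * exp (- (x ^ 6) + t * x\<^sup>2)) \<longlongrightarrow> 0) at_top"
      by real_asymp
    then show ?thesis
    proof (rule Lim_transform_eventually)
      show "\<forall>\<^sub>F x in at_top. x powr (real n + 2 * lam + 1) * exp (- (x ^ 6) + t * x\<^sup>2) = x ^ n * freud_weight t lam x"
        using eventually_gt_at_top[of 0]
        by eventually_elim (simp add: freud_weight_def powr_add powr_realpow)
    qed
  qed
  then have "((\<lambda>x. \<Sum>i\<le>degree p. coeff p i * (x ^ i * freud_weight t lam x)) \<longlongrightarrow> (\<Sum>i\<le>degree p. coeff p i * 0)) at_top"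
    by (intro tendsto_sum tendsto_mult tendsto_const)
  then show ?thesis by (simp add: poly_altdef sum_distrib_right mult.assoc)
qed

lemma poly_weight_at_bot: "((\<lambda>x. poly p x * freud_weight t lam x) \<longlongrightarrow> 0) at_bot"
  using poly_weight_at_top[of "mirror p"] unfolding filterlim_at_bot_mirror
  by (simp add: weight_even)

lemma integral_split_at_0:
  fixes f :: "real \<Rightarrow> real"
  assumes "integrable lborel f"
  shows "integral\<^sup>L lborel f = (LBINT x=-\<infinity>..0. f x) + (LBINT x=0..\<infinity>. f x)"
proof -
  have "(LBINT x=-\<infinity>..\<infinity>. f x) = (LBINT x=-\<infinity>..0. f x) + (LBINT x=0..\<infinity>. f x)"
    by (rule interval_integral_sum[symmetric])
      (use assms in \<open>simp add: interval_lebesgue_integrable_def set_integrable_def\<close>)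
  then show ?thesis
    by (simp add: interval_lebesgue_integral_def set_lebesgue_integral_def)
qed

context
  fixes t lam :: real
  assumes lam: "lam > -1"
begin

lemma monomial_weight_integrable: "integrable lborel (\<lambda>x. x ^ n * freud_weight t lam x)"
proof -
  define s where "s = real n + 2 * lam + 2"
  have s: "s > 0" using lam by (simp add: s_def)
  \<comment> \<open>The integrand of \<open>Gamma s\<close>; \<open>g x + g (- x)\<close> is its even extension away from \<open>0\<close>.\<close>
  define g where "g x = indicator {0..} x * x powr (s - 1) / exp x" for x :: real
  have "integrable lborel g"
  proof (rule integrableI_nonneg)
    have "(\<integral>\<^sup>+ x. ennreal (g x) \<partial>lborel) = Gamma s"
      unfolding g_def using Gamma_conv_nn_integral_real[OF s] by simp
    then show "(\<integral>\<^sup>+ x. ennreal (g x) \<partial>lborel) < \<infinity>" by simp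
  qed (auto simp: g_def[abs_def])
  moreover from this have "integrable lborel (\<lambda>x. g (0 + (- 1) * x))"
    by (rule lborel_integrable_real_affine) simp
  ultimately have "integrable lborel (\<lambda>x. exp (1 + (1 + \<bar>t\<bar>)\<^sup>2) * (g x + g (- x)))"
    by (intro integrable_mult_right integrable_add) auto
  then show ?thesis
  proof (rule Bochner_Integration.integrable_bound)
    show "AE x in lborel. norm (x ^ n * freud_weight t lam x) \<le> norm (exp (1 + (1 + \<bar>t\<bar>)\<^sup>2) * (g x + g (- x)))"
    proof (rule AE_I2)
      fix x :: real
      show "norm (x ^ n * freud_weight t lam x) \<le> norm (exp (1 + (1 + \<bar>t\<bar>)\<^sup>2) * (g x + g (- x)))"
      proof (cases "x = 0")
        case True
        then show ?thesis by (simp add: freud_weight_def)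
      next
        case False
        define y where "y = \<bar>x\<bar>"
        have y: "y > 0" using False by (simp add: y_def)
        have g: "g x + g (- x) = y powr (s - 1) * exp (- y)"
          using False by (cases "0 < x") (auto simp: g_def y_def exp_minus field_simps)
        have xy: "x ^ 6 = y ^ 6" "x\<^sup>2 = y\<^sup>2" by (simp_all add: y_def)
        have "norm (x ^ n * freud_weight t lam x) = y ^ n * y powr (2 * lam + 1) * exp (- (y ^ 6) + t * y\<^sup>2)"
          by (simp add: freud_weight_def abs_mult power_abs xy flip: y_def)
        also have "\<dots> = y powr (s - 1) * exp (- (y ^ 6) + t * y\<^sup>2)"
        proof -
          have "s - 1 = real n + (2 * lam + 1)" by (simp add: s_def)
          then show ?thesis using y by (simp only: powr_add powr_realpow)
        qed
        also have "\<dots> \<le> y powr (s - 1) * exp (1 + (1 + \<bar>t\<bar>)\<^sup>2 - y)"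
          using sextic_bound[of y t] y by (intro mult_left_mono) auto
        also have "\<dots> = exp (1 + (1 + \<bar>t\<bar>)\<^sup>2) * (g x + g (- x))"
          unfolding g by (simp add: exp_diff exp_minus field_simps)
        finally show ?thesis by simp
      qed
    qed
  qed simp
qed

lemma poly_weight_integrable: "integrable lborel (\<lambda>x. poly p x * freud_weight t lam x)"
  unfolding poly_altdef sum_distrib_right mult.assoc
  by (intro Bochner_Integration.integrable_sum integrable_mult_right monomial_weight_integrable)

text \<open>The factor \<open>X\<close> raises the exponent of \<open>|x|\<close> to \<open>2 \<lambda> + 2 > 0\<close>.\<close>

lemma poly_weight_at_0: "((\<lambda>x. poly (X * r) x * freud_weight t lam x) \<longlongrightarrow> 0) (at 0)"
proof (rule Lim_null_comparison)
  show "\<forall>\<^sub>F x in at 0. norm (poly (X * r) x * freud_weight t lam x)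
      \<le> \<bar>x\<bar> powr (2 * lam + 2) * (\<bar>poly r x\<bar> * exp (- (x ^ 6) + t * x\<^sup>2))"
    unfolding eventually_at_filter
  proof (rule always_eventually, safe)
    fix x :: real assume "x \<noteq> 0"
    then have "\<bar>x\<bar> powr (2 * lam + 2) = \<bar>x\<bar> * \<bar>x\<bar> powr (2 * lam + 1)"
      using powr_add[of "\<bar>x\<bar>" 1 "2 * lam + 1"] by (simp add: add.commute)
    then show "norm (poly (X * r) x * freud_weight t lam x)
      \<le> \<bar>x\<bar> powr (2 * lam + 2) * (\<bar>poly r x\<bar> * exp (- (x ^ 6) + t * x\<^sup>2))"
      by (simp add: freud_weight_def abs_mult)
  qed
  have "((\<lambda>x. \<bar>x\<bar> powr (2 * lam + 2) * (\<bar>poly r x\<bar> * exp (- (x ^ 6) + t * x\<^sup>2)))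
      \<longlongrightarrow> \<bar>0\<bar> powr (2 * lam + 2) * (\<bar>poly r 0\<bar> * exp (- (0 ^ 6) + t * 0\<^sup>2))) (at 0)"
    by (intro tendsto_intros tendsto_powr') (use lam in auto)
  then show "((\<lambda>x. \<bar>x\<bar> powr (2 * lam + 2) * (\<bar>poly r x\<bar> * exp (- (x ^ 6) + t * x\<^sup>2)))
      \<longlongrightarrow> 0) (at 0)" by simp
qed

text \<open>The integrand is the derivative of the product of \<open>x r(x)\<close> and the weight, except at the origin, where the
weight may be singular. Hence the fundamental theorem of calculus is applied on the two half-lines
separately; all four boundary values are zero.\<close>

lemma weight_pearson:
  "integral\<^sup>L lborel (\<lambda>x. poly (pderiv (X * r) + smult (2 * lam + 1) r
     - sextic_slope t * (X * r)) x * freud_weight t lam x) = 0"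
proof -
  define F where "F x = poly (X * r) x * freud_weight t lam x" for x
  define f where "f x = poly (pderiv (X * r) + smult (2 * lam + 1) r
     - sextic_slope t * (X * r)) x * freud_weight t lam x" for x
  have F: "(F has_vector_derivative f x) (at x)" if "x \<noteq> 0" for x
    unfolding F_def f_def has_real_derivative_iff_has_vector_derivative[symmetric]
    by (rule weight_derivative[OF that])
  have cont: "isCont f x" if "x \<noteq> 0" for x
    unfolding f_def by (rule weight_isCont[OF that])
  have int: "integrable lborel f" unfolding f_def by (rule poly_weight_integrable)
  have int': "set_integrable lborel A f" if "A \<in> sets lborel" for A
    unfolding set_integrable_def using int that by (intro integrable_mult_indicator)
  have 0: "(F \<longlongrightarrow> 0) (at_left 0)" "(F \<longlongrightarrow> 0) (at_right 0)"
    using poly_weight_at_0[of r] unfolding F_def by (simp_all add: filterlim_at_split)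
  have "(LBINT x=0..\<infinity>. f x) = 0 - 0"
  proof (rule interval_integral_FTC_integrable[of 0 \<infinity> F])
    show "((F \<circ> real_of_ereal) \<longlongrightarrow> 0) (at_right 0)"
      using 0 by (simp add: ereal_tendsto_simps zero_ereal_def)
    show "((F \<circ> real_of_ereal) \<longlongrightarrow> 0) (at_left \<infinity>)"
      using poly_weight_at_top[of "X * r"] by (simp add: ereal_tendsto_simps F_def[abs_def])
  qed (auto intro!: F cont int' simp: zero_ereal_def)
  moreover have "(LBINT x=-\<infinity>..0. f x) = 0 - 0"
  proof (rule interval_integral_FTC_integrable[of "-\<infinity>" 0 F])
    show "((F \<circ> real_of_ereal) \<longlongrightarrow> 0) (at_left 0)"
      using 0 by (simp add: ereal_tendsto_simps zero_ereal_def)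
    show "((F \<circ> real_of_ereal) \<longlongrightarrow> 0) (at_right (-\<infinity>))"
      using poly_weight_at_bot[of "X * r"] by (simp add: ereal_tendsto_simps F_def[abs_def])
  qed (auto intro!: F cont int' simp: zero_ereal_def)
  ultimately have "integral\<^sup>L lborel f = 0" using integral_split_at_0[OF int] by simp
  then show ?thesis by (simp only: f_def[abs_def])
qed

text \<open>A vanishing integral would force the integrand to vanish almost everywhere, but it is zero only at
the origin and at the finitely many roots of \<open>p\<close>.\<close>

lemma weight_pos:
  assumes "p \<noteq> 0"
  shows "0 < integral\<^sup>L lborel (\<lambda>x. poly (p * p) x * freud_weight t lam x)"
proof -
  let ?f = "\<lambda>x. poly (p * p) x * freud_weight t lam x"
  have nn: "0 \<le> ?f x" for x using weight_nonneg by simp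
  have "integral\<^sup>L lborel ?f \<noteq> 0"
  proof
    assume "integral\<^sup>L lborel ?f = 0"
    then have "AE x in lborel. ?f x = 0"
      using integral_nonneg_eq_0_iff_AE[OF poly_weight_integrable[of "p * p"]] nn by simp
    moreover have "finite ({x. poly p x = 0} \<union> {0})" using poly_roots_finite[OF assms] by simp
    then have "AE x in lborel. x \<notin> {x. poly p x = 0} \<union> {0}"
      by (intro AE_not_in finite_imp_null_set_lborel)
    ultimately have "AE x::real in lborel. False"
      by eventually_elim (auto simp: freud_weight_def)
    then show False by (simp add: eventually_False ae_filter_eq_bot_iff)
  qed
  moreover have "0 \<le> integral\<^sup>L lborel ?f" using nn by (intro integral_nonneg_AE) auto
  ultimately show ?thesis by simp
qed

end

definition freud_integral :: "real \<Rightarrow> real \<Rightarrow> real poly \<Rightarrow> real" where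
  "freud_integral t lam p = integral\<^sup>L lborel (\<lambda>x. poly p x * freud_weight t lam x)"

lemma freud_functional_freud_integral:
  assumes "lam > -1"
  shows "freud_functional (freud_integral t lam) (2 * lam + 1) (sextic_slope t) t"
proof -
  note int [simp] = poly_weight_integrable[OF assms, of _ t]
  have add: "freud_integral t lam (p + q) = freud_integral t lam p + freud_integral t lam q" for p q
    unfolding freud_integral_def by (simp add: distrib_right)
  have smult: "freud_integral t lam (smult c p) = c * freud_integral t lam p" for c p
    unfolding freud_integral_def by (simp add: mult.assoc)
  have minus: "freud_integral t lam (p - q) = freud_integral t lam p - freud_integral t lam q" for p q
    unfolding freud_integral_def by (simp add: left_diff_distrib)
  show ?thesis
  proof
    show "0 < freud_integral t lam (p * p)" if "p \<noteq> 0" for p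
      unfolding freud_integral_def by (rule weight_pos[OF assms that])
    show "freud_integral t lam (mirror p) = freud_integral t lam p" for p
      using lborel_integral_real_affine[of "- 1" "\<lambda>x. poly p x * freud_weight t lam x" 0]
      by (simp add: freud_integral_def weight_even)
    show "mirror (sextic_slope t) = - sextic_slope t"
      by (rule poly_ext) (simp add: algebra_simps)
    fix r
    have "freud_integral t lam (pderiv (X * r) + smult (2 * lam + 1) r - sextic_slope t * (X * r)) = 0"
      unfolding freud_integral_def by (rule weight_pearson[OF assms])
    then show "freud_integral t lam (pderiv (X * r)) + (2 * lam + 1) * freud_integral t lam r
        = freud_integral t lam (sextic_slope t * (X * r))"
      by (simp only: add smult minus)
  qed (fact add smult refl)+
qed

section \<open>The differential-difference equation\<close>

theorem theorem4p1:
  fixes t lam x :: real and n :: nat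
  assumes "lam > -1"
  shows "x * deriv (poly (freud_S t lam (int n))) x =
           freud_A t lam n x * poly (freud_S t lam (int n - 1)) x
         - freud_B t lam n x * poly (freud_S t lam (int n)) x"
proof -
  define S where "S = freud_S t lam"
  define b where "b = freud_\<beta> t lam"
  interpret freud_functional "freud_integral t lam" "2 * lam + 1" "sextic_slope t" t
    by (rule freud_functional_freud_integral[OF assms])
  have iff: "monic_orthogonal_polys (freud_weight t lam) P \<longleftrightarrow> monic_OPS P" for P
    using poly_weight_integrable[OF assms, of "P _ * P _" t]
    by (simp add: monic_orthogonal_polys_def monic_OPS_def has_bochner_integral_iff freud_integral_def)
  \<comment> \<open>By existence and uniqueness, the definite description has a value.\<close>
  have "(THE P. monic_orthogonal_polys (freud_weight t lam) P) = gram_schmidt"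
    unfolding iff using OPS_exists OPS_unique by (intro the_equality) auto
  then have S: "S k = (if k < 0 then 0 else gram_schmidt (nat k))" for k
    by (simp add: S_def freud_S_def)
  then have OPS: "monic_OPS (\<lambda>n. S (int n))" using OPS_exists by simp
  have b0: "b k = 0" if "k \<le> 0" for k using that by (simp add: b_def freud_\<beta>_def)
  have rec: "S (k + 1) = X * S k - smult (b k) (S (k - 1))" if "0 \<le> k" for k
  proof (cases "k = 0")
    case True
    then show ?thesis using OPS_first[OF OPS] S[of "-1"] by (simp add: b0)
  next
    case False
    define m where "m = nat (k - 1)"
    have k: "k = int m + 1" using False that by (simp add: m_def)
    obtain c where c: "S (k + 1) = X * S k - smult c (S (k - 1))"
      using OPS_three_term[OF OPS, of m] k by (auto simp: add.commute)
    have "S (k - 1) \<noteq> 0" using OPS_coeff(1)[OF OPS, of m] k by auto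
    have "c' = c" if "S (k + 1) = X * S k - smult c' (S (k - 1))" for c'
    proof -
      have "smult (c' - c) (S (k - 1)) = 0" using that c by (simp add: smult_diff_left)
      then show ?thesis using \<open>S (k - 1) \<noteq> 0\<close> by simp
    qed
    then have "(THE c. S (k + 1) = X * S k - smult c (S (k - 1))) = c"
      using c by (intro the_equality) auto
    then show ?thesis using c k by (simp add: b_def freud_\<beta>_def S_def)
  qed
  \<comment> \<open>By parity, \<open>S\<^sub>n\<close> is its own odd part if \<open>n\<close> is odd and has odd part zero if \<open>n\<close> is even.\<close>
  have odd: "x * poly (odd_quot (S (int n))) x = (1 - (- 1) ^ n) / 2 * poly (S (int n)) x"
    using OPS_parity[OF OPS, of n] poly_mirror[of "S (int n)" x]
    by (simp add: poly_odd_quot left_diff_distrib diff_divide_distrib)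
  have "x * poly (dunkl (S (int n))) x
      = x * poly (pderiv (S (int n))) x + (2 * lam + 1) * (x * poly (odd_quot (S (int n))) x)"
    by (simp only: dunkl_def poly_add poly_smult) (simp add: algebra_simps)
  also have "\<dots> = x * poly (pderiv (S (int n))) x
      + (lam + 1 / 2) * (1 - (- 1) ^ n) * poly (S (int n)) x"
    unfolding odd by (simp add: field_simps)
  finally have dunkl: "x * poly (pderiv (S (int n))) x = x * poly (dunkl (S (int n))) x
      - (lam + 1 / 2) * (1 - (- 1) ^ n) * poly (S (int n)) x" by simp
  have neg: "S k = 0" if "k < 0" for k using that by (simp add: S)
  have deriv: "deriv (poly p) x = poly (pderiv p) x" for p :: "real poly"
    by (intro DERIV_imp_deriv poly_DERIV)
  have lowering: "poly (dunkl (S (int n))) x =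
      6 * b k * (x ^ 4 - t / 3 + x\<^sup>2 * (b k + b (k + 1)) + b (k + 2) * b (k + 1)
        + (b (k + 1) + b k)\<^sup>2 + b (k - 1) * b k) * poly (S (k - 1)) x
      - 6 * x * b k * (x\<^sup>2 + b (k + 1) + b k + b (k - 1)) * poly (S k) x" if "k = int n" for k
    unfolding that by (rule dunkl_lowering[OF OPS neg b0 rec])
  show ?thesis
    unfolding freud_A_def freud_B_def Let_def S_def[symmetric] b_def[symmetric] deriv dunkl
      lowering[OF refl]
    by (simp add: algebra_simps power2_eq_square)
qed

end
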